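(* Let $F$ and $G$ be two noncommutative local functionals over the infinite jet superspace, and suppose that $F$ is homogeneous. The Batalin–Vilkovisky Laplacian $\Delta$ satisfies the relation $$\Delta\bigl([\![F,G]\!]\bigr)=[\![\Delta F,G]\!]+(-1)^{|F|-1}[\![F,\Delta G]\!].$$
   Context: **Letters and cyclic words.** The ground field is $\mathbb{R}$. $M^n$ is an oriented affine real manifold of dimension $n$, with local affine coordinates $x=(x^1,\dots,x^n)$ and a volume element $\mathrm{dvol}(x)$. The alphabet consists of even letters $a^i_\sigma$ (degree $0$) and odd letters $b_{j,\tau}$ (degree $1$), $1\le i,j\le m$, where $\sigma,\tau$ are multi-indices ($a^i=a^i_\varnothing$, $b_j=b_{j,\varnothing}$); $[a],[b]$ denote dependence on finitely many of these jet letters. The degree $|w|$ of a word is the number of its odd letters. A cyclic word $(w)$ is the class of an element $w$ of the free associative algebra on these letters (with coefficients in $C^\infty(M^n)$) modulo the linear relation $w\sim\mathfrak{t}(w)$, $\mathfrak{t}(\gamma_1\cdots\gamma_\lambda)=(-1)^{|\gamma_1\cdots\gamma_{\lambda-1}|\cdot|\gamma_\lambda|}\gamma_\lambda\gamma_1\cdots\gamma_{\lambda-1}$. For words of lengths $\lambda(w_1),\lambda(w_2)>0$ put $$(w_1)\times(w_2)=\frac{1}{\lambda(w_1)\lambda(w_2)}\sum_{i=1}^{\lambda(w_1)}\sum_{j=1}^{\lambda(w_2)}\bigl(\mathfrak{t}^{i-1}(w_1)\,\mathfrak{t}^{j-1}(w_2)\bigr),$$ extended bilinearly, zero-length words being scalars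 acting by multiplication. This product is graded commutative and not associative. The total derivative $D_{x^k}$ is the derivation equal to $\partial/\partial x^k$ on coefficients with $a^i_\sigma\mapsto a^i_{\sigma\cup\{k\}}$, $b_{j,\tau}\mapsto b_{j,\tau\cup\{k\}}$. **Functionals.** An integral functional is $F=\int f(x,[a],[b])\,\mathrm{dvol}(x)$ with $f$ a (sum of) cyclic word(s), modulo integration by parts without boundary terms (coefficients are smooth and, if $M^n$ is not closed, decay rapidly towards the boundary or infinity). The product of $F_1,F_2$ is $F_1\times F_2=\iint f_1|_{x_1}\times f_2|_{x_2}\,\mathrm{dvol}(x_1)\mathrm{dvol}(x_2)$ over $M^n\times M^n$. Local functionals are linear combinations of products of $\ell\ge0$ integral functionals (with a specified bracketing; default $(\cdots(F_1\times F_2)\times\cdots)\times F_\ell$). Each letter in such a product remembers the factor $F_\alpha$, and the copy of $M^n$, from which it comes; the total derivatives $D^{(\alpha)}$ over the $\alpha$-th copy act only on the letters and coefficients of the $\alpha$-th factor. **Derivatives.** $\overrightarrow\partial/\partial b_{i,\tau}$ acts on a cyclic word by deletion without changing the cyclic order of the remaining letters: $(c_1\cdots c_\lambda)\mapsto\sum_{\nu:\,c_\nu=b_{i,\tau}}(-1)^{|c_1\cdots c_{\nu-1}|}(c_1\cdots c_{\nu-1}c_{\nu+1}\cdots c_\lambda)$; similarly (without signs) for $\partial/\partial a^i_\sigma$. The right-acting derivative is $(w)\overleftarrow\partial/\partial b_{i,\tau}=(-1)^{|w|-1}\overrightarrow\partial w/\partial b_{i,\tau}$. **BV Laplacian.**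 For an integral functional, $\Delta F=\int\sum_i\sum_{\sigma,\tau}(-D)^{\sigma\cup\tau}\frac{\overrightarrow\partial^2f}{\partial a^i_\sigma\,\partial b_{i,\tau}}\,\mathrm{dvol}(x)$. On a product with density word $h$, $\Delta$ acts by $\sum_{\alpha,\beta}\sum_i\sum_{\sigma,\tau}(-D^{(\alpha)})^\sigma(-D^{(\beta)})^\tau\frac{\overrightarrow\partial^{(\alpha)}}{\partial a^i_\sigma}\frac{\overrightarrow\partial^{(\beta)}}{\partial b_{i,\tau}}h$, where the superscripts say from which factor the deleted letter is taken and, for $\alpha\ne\beta$, the copies $\alpha,\beta$ of $M^n$ are identified along the diagonal $x_\alpha=x_\beta$. **Schouten bracket.** For $F$ homogeneous, the bracket $[\![\,,]\!]$ is defined by $\Delta(F\times G)=\Delta F\times G+(-1)^{|F|}[\![F,G]\!]+(-1)^{|F|}F\times\Delta G$. Here $\Delta F\times G$ and $F\times\Delta G$ are the parts of $\Delta(F\times G)$ in which both deleted letters come from $F$, resp. from $G$. Explicitly, for integral functionals, $[\![F,G]\!]=\int\sum\bigl\{(f)\frac{\overleftarrow\partial}{\partial a^i_\sigma}(-\overleftarrow D)^\sigma\times(-\overrightarrow D)^\tau\frac{\overrightarrow\partial}{\partial b_{i,\tau}}(g)-(f)\frac{\overleftarrow\partial}{\partial b_{i,\sigma}}(-\overleftarrow D)^\sigma\times(-\overrightarrow D)^\tau\frac{\overrightarrow\partial}{\partial a^i_\tau}(g)\bigr\}\mathrm{dvol}(x)$, where the product word $f\times g$ is formed first and the derivatives then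 act on the letters of the respective factor. **Conventions for composed expressions.** (1) Multiplication first, variation afterwards: in any expression containing $\Delta$, $[\![\,,]\!]$ and several functionals, first the product word (with its bracketing) is formed, and then the operators act on the letters of the indicated factors inside it, with the usual graded signs. (2) When $\Delta$ and $[\![\,,]\!]$ are composed, all partial derivatives act on the densities first, while the total derivatives (each over its own copy of $M^n$, acting only on what remains of the respective density) and the restriction to the diagonals are performed at the very end. *)

theory Defs
  imports "HOL-Analysis.Analysis" "HOL-Library.Multiset"
begin

section \<open>Oriented affine manifolds\<close>

text \<open>The points of the manifold form the whole type \<open>'p\<close>. A chart is a domain together with
  local coordinates; the values of the coordinate map outside of the domain are irrelevant.\<close>

type_synonym ('p, 'n) chart = "'p set \<times> ('p \<Rightarrow> real ^ 'n)"

definition chart_line :: "('p, 'n::finite) chart \<Rightarrow> 'n \<Rightarrow> 'p \<Rightarrow> real \<Rightarrow> 'p" where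
  "chart_line c k p t = inv_into (fst c) (snd c) (snd c p + t *\<^sub>R axis k 1)"

definition chart_deriv :: "('p, 'n::finite) chart \<Rightarrow> 'n \<Rightarrow> ('p \<Rightarrow> real) \<Rightarrow> 'p \<Rightarrow> real" where
  "chart_deriv c k u p = deriv (\<lambda>t. u (chart_line c k p t)) 0"

text \<open>The Jacobi matrix of the coordinates of \<open>c'\<close> with respect to those of \<open>c\<close>.\<close>

definition jac :: "('p, 'n::finite) chart \<Rightarrow> ('p, 'n) chart \<Rightarrow> 'p \<Rightarrow> real ^ 'n ^ 'n" where
  "jac c c' p = (\<chi> l k. chart_deriv c k (\<lambda>q. snd c' q $ l) p)"

text \<open>Functions of several points, one for each copy \<open>\<kappa>\<close> of the manifold; \<open>C\<close> selects a chart
  and \<open>X\<close> a point of every copy. Only the copies in \<open>P\<close> matter.\<close>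

definition admissible ::
  "('p, 'n) chart set \<Rightarrow> 't set \<Rightarrow> ('t \<Rightarrow> ('p, 'n) chart) \<Rightarrow> ('t \<Rightarrow> 'p) \<Rightarrow> bool" where
  "admissible atlas P C X \<longleftrightarrow> (\<forall>\<kappa>\<in>P. C \<kappa> \<in> atlas \<and> X \<kappa> \<in> fst (C \<kappa>))"

definition copy_deriv ::
  "('t \<Rightarrow> ('p, 'n::finite) chart) \<Rightarrow> 't \<Rightarrow> 'n \<Rightarrow> (('t \<Rightarrow> 'p) \<Rightarrow> real) \<Rightarrow> ('t \<Rightarrow> 'p) \<Rightarrow> real" where
  "copy_deriv C \<kappa> k v X = chart_deriv (C \<kappa>) k (\<lambda>p. v (X(\<kappa> := p))) (X \<kappa>)"

text \<open>Smoothness: all iterated partial derivatives exist and are (jointly) continuous.\<close>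

definition smooth_coeff ::
  "('p::topological_space, 'n::finite) chart set \<Rightarrow> 't set
    \<Rightarrow> (('t \<Rightarrow> ('p, 'n) chart) \<Rightarrow> ('t \<Rightarrow> 'p) \<Rightarrow> real) \<Rightarrow> bool" where
  "smooth_coeff atlas P u \<longleftrightarrow>
    (\<forall>C ds. (\<forall>\<kappa>\<in>P. C \<kappa> \<in> atlas) \<and> fst ` set ds \<subseteq> P \<longrightarrow>
      (let v = foldr (\<lambda>(\<kappa>, k). copy_deriv C \<kappa> k) ds (u C) in
        continuous_on {X. \<forall>\<kappa>\<in>P. X \<kappa> \<in> fst (C \<kappa>)} v \<and>
        (\<forall>X. (\<forall>\<kappa>\<in>P. X \<kappa> \<in> fst (C \<kappa>)) \<longrightarrow>
          (\<forall>\<kappa>\<in>P. \<forall>k. (\<lambda>t. v (X(\<kappa> := chart_line (C \<kappa>) k (X \<kappa>) t)))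
             differentiable (at 0)))))"

definition smooth_family ::
  "('p::topological_space, 'n::finite) chart set \<Rightarrow> (('p, 'n) chart \<Rightarrow> 'p \<Rightarrow> real) \<Rightarrow> bool" where
  "smooth_family atlas u \<longleftrightarrow> smooth_coeff atlas {()} (\<lambda>C X. u (C ()) (X ()))"

text \<open>\<open>vol c\<close> is the coefficient of the volume element with respect to the coordinates of \<open>c\<close>.\<close>

locale affine_manifold =
  fixes atlas :: "('p::{t2_space, second_countable_topology}, 'n::finite) chart set"
    and vol :: "('p, 'n) chart \<Rightarrow> 'p \<Rightarrow> real"
  assumes covers: "(\<Union>c\<in>atlas. fst c) = UNIV"
    and chart: "c \<in> atlas \<Longrightarrow> open (fst c) \<and> open (snd c ` fst c) \<and>
      (\<exists>g. homeomorphism (fst c) (snd c ` fst c) (snd c) g)"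
    and oriented_affine: "c \<in> atlas \<Longrightarrow> c' \<in> atlas \<Longrightarrow> p \<in> fst c \<inter> fst c' \<Longrightarrow>
      \<exists>A b. det A > 0 \<and> (\<forall>\<^sub>F q in nhds p. snd c' q = A *v snd c q + b)"
    and vol_smooth: "smooth_family atlas vol"
    and vol_pos: "c \<in> atlas \<Longrightarrow> p \<in> fst c \<Longrightarrow> vol c p > 0"
    and vol_change: "c \<in> atlas \<Longrightarrow> c' \<in> atlas \<Longrightarrow> p \<in> fst c \<inter> fst c' \<Longrightarrow>
      vol c p = det (jac c c' p) * vol c' p"

definition volume_measure :: "('p::topological_space, 'n::finite) chart set
    \<Rightarrow> (('p, 'n) chart \<Rightarrow> 'p \<Rightarrow> real) \<Rightarrow> 'p measure \<Rightarrow> bool" where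
  "volume_measure atlas vol \<mu> \<longleftrightarrow> sets \<mu> = sets borel \<and>
    (\<forall>c\<in>atlas. \<forall>B\<in>sets borel. B \<subseteq> fst c \<longrightarrow>
      emeasure \<mu> B = (\<integral>\<^sup>+ y \<in> snd c ` B. ennreal (vol c (inv_into (fst c) (snd c) y)) \<partial>lborel))"

text \<open>The coefficients of densities depend on the chart, since the jet letters do. ``Rapid'' decay
  has no canonical meaning on an affine manifold, so the class \<open>S\<close> of decaying coefficients is a
  parameter. It is required that vector fields with coefficients in \<open>S\<close> can be integrated by parts
  without boundary terms (\<open>no_boundary\<close>). By \<open>test\<close>, the class consists of all smooth coefficients
  if the manifold is compact.\<close>

locale decay_class =
  fixes atlas :: "('p::topological_space, 'n::finite) chart set"
    and vol :: "('p, 'n) chart \<Rightarrow> 'p \<Rightarrow> real"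
    and S :: "(('p, 'n) chart \<Rightarrow> 'p \<Rightarrow> real) set"
  assumes smooth: "u \<in> S \<Longrightarrow> smooth_family atlas u"
    and test: "smooth_family atlas u \<Longrightarrow> compact K \<Longrightarrow>
      (\<And>c p. c \<in> atlas \<Longrightarrow> p \<in> fst c - K \<Longrightarrow> u c p = 0) \<Longrightarrow> u \<in> S"
    and lincomb: "u \<in> S \<Longrightarrow> v \<in> S \<Longrightarrow> (\<lambda>c p. r * u c p + s * v c p) \<in> S"
    and mult: "u \<in> S \<Longrightarrow> v \<in> S \<Longrightarrow> (\<lambda>c p. u c p * v c p) \<in> S"
    and diff: "u \<in> S \<Longrightarrow> (\<lambda>c. chart_deriv c k (u c)) \<in> S"
    and vanish: "u \<in> S \<Longrightarrow> c \<in> atlas \<Longrightarrow> 0 < e \<Longrightarrow>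
      \<exists>K. compact K \<and> (\<forall>p \<in> fst c - K. \<bar>u c p\<bar> < e)"
    and no_boundary: "volume_measure atlas vol \<mu> \<Longrightarrow> (\<And>k. V k \<in> S) \<Longrightarrow>
      (\<And>c c' p l. c \<in> atlas \<Longrightarrow> c' \<in> atlas \<Longrightarrow> p \<in> fst c \<inter> fst c' \<Longrightarrow>
         V l c' p = (\<Sum>k\<in>UNIV. jac c c' p $ l $ k * V k c p)) \<Longrightarrow>
      (\<And>c p. c \<in> atlas \<Longrightarrow> p \<in> fst c \<Longrightarrow>
         g p = (\<Sum>k\<in>UNIV. chart_deriv c k (\<lambda>q. vol c q * V k c q) p) / vol c p) \<Longrightarrow>
      has_bochner_integral \<mu> g 0"


section \<open>Letters and cyclic words\<close>

text \<open>\<open>Even i \<sigma>\<close> is $a^i_\sigma$ and \<open>Odd i \<tau>\<close> is $b_{i,\tau}$. A letter carries the label of the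
  copy of the manifold it comes from.\<close>

datatype ('m, 'n) jet = Even 'm "'n multiset" | Odd 'm "'n multiset"

fun prolong :: "'n \<Rightarrow> ('m, 'n) jet \<Rightarrow> ('m, 'n) jet" where
  "prolong k (Even i \<sigma>) = Even i (add_mset k \<sigma>)"
| "prolong k (Odd i \<tau>) = Odd i (add_mset k \<tau>)"

fun is_odd :: "('m, 'n) jet \<Rightarrow> bool" where
  "is_odd (Even i \<sigma>) = False"
| "is_odd (Odd i \<tau>) = True"

type_synonym ('t, 'm, 'n) wrd = "('t \<times> ('m, 'n) jet) list"

definition odd_count :: "'t set \<Rightarrow> ('t, 'm, 'n) wrd \<Rightarrow> nat" where
  "odd_count A w = length (filter (\<lambda>(\<kappa>, y). \<kappa> \<in> A \<and> is_odd y) w)"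

abbreviation wdeg :: "('t, 'm, 'n) wrd \<Rightarrow> nat" where
  "wdeg \<equiv> odd_count UNIV"

text \<open>The rotation $\mathfrak t$, acting on a word with a sign in front.\<close>

fun rot :: "real \<times> ('t, 'm, 'n) wrd \<Rightarrow> real \<times> ('t, 'm, 'n) wrd" where
  "rot (s, w) = (if w = [] then (s, w)
     else (s * (-1) ^ (wdeg (butlast w) * wdeg [last w]), last w # butlast w))"

text \<open>An element \<open>v\<close> of the free algebra (as its function of coefficients) is zero as a cyclic word
  iff it is of the form $g - \mathfrak t(g)$; note that rotation permutes the words up to signs.\<close>

definition cyclic_null :: "(('t, 'm, 'n) wrd \<Rightarrow> real) \<Rightarrow> bool" where
  "cyclic_null v \<longleftrightarrow> (\<exists>g. finite {w. g w \<noteq> 0} \<and>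
     (\<forall>w. v (snd (rot (1, w))) = g (snd (rot (1, w))) - fst (rot (1, w)) * g w))"


section \<open>Densities in several copies of the manifold\<close>

text \<open>An element of the algebra of words with smooth coefficients is a formal sum of monomials.\<close>

type_synonym ('t, 'p, 'n) coeff = "('t \<Rightarrow> ('p, 'n) chart) \<Rightarrow> ('t \<Rightarrow> 'p) \<Rightarrow> real"

type_synonym ('t, 'p, 'm, 'n) mono = "('t, 'p, 'n) coeff \<times> ('t, 'm, 'n) wrd"

definition val :: "('t, 'p, 'm, 'n) mono list
    \<Rightarrow> ('t \<Rightarrow> ('p, 'n) chart) \<Rightarrow> ('t \<Rightarrow> 'p) \<Rightarrow> ('t, 'm, 'n) wrd \<Rightarrow> real" where
  "val ms C X w = (\<Sum>(u, v)\<leftarrow>ms. if v = w then u C X else 0)"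

text \<open>The total derivative over the copy \<open>\<kappa>\<close>.\<close>

fun total_deriv :: "'t \<Rightarrow> 'n \<Rightarrow> ('t, 'p, 'm, 'n::finite) mono \<Rightarrow> ('t, 'p, 'm, 'n) mono list" where
  "total_deriv \<kappa> k (u, w) = (\<lambda>C. copy_deriv C \<kappa> k (u C), w) #
     [(u, w[j := (\<kappa>, prolong k y)]). (j, (\<kappa>', y)) \<leftarrow> List.enumerate 0 w, \<kappa>' = \<kappa>]"

definition total_derivs ::
  "('t \<times> 'n) list \<Rightarrow> ('t, 'p, 'm, 'n::finite) mono \<Rightarrow> ('t, 'p, 'm, 'n) mono list" where
  "total_derivs ds m = foldr (\<lambda>(\<kappa>, k) ms. concat (map (total_deriv \<kappa> k) ms)) ds [m]"

text \<open>Change of coordinates with Jacobi matrix \<open>A\<close>: as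
  $\partial_{x^k} = \sum_l A_{lk}\,\partial_{x'^l}$, one has
  $a_{k_1\cdots k_r} = \sum_{l_1,\dots,l_r} A_{l_1k_1}\cdots A_{l_rk_r}\,a'_{l_1\cdots l_r}$.
  The value of \<open>index_change A \<sigma> \<sigma>'\<close> is the coefficient of $a'_{\sigma'}$ in $a_\sigma$;
  it does not depend on the enumeration of \<open>\<sigma>\<close>.\<close>

definition index_change :: "real ^ 'n ^ 'n \<Rightarrow> 'n multiset \<Rightarrow> 'n multiset \<Rightarrow> real" where
  "index_change A \<sigma> \<sigma>' = (let ks = (SOME ks. mset ks = \<sigma>) in
     \<Sum>ls | mset ls = \<sigma>'. if length ls = length ks
       then \<Prod>r<length ks. A $ (ls ! r) $ (ks ! r) else 0)"

fun jet_change :: "real ^ 'n ^ 'n \<Rightarrow> ('m, 'n) jet \<Rightarrow> ('m, 'n) jet \<Rightarrow> real" where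
  "jet_change A (Even i \<sigma>) (Even j \<sigma>') = (if i = j then index_change A \<sigma> \<sigma>' else 0)"
| "jet_change A (Odd i \<sigma>) (Odd j \<sigma>') = (if i = j then index_change A \<sigma> \<sigma>' else 0)"
| "jet_change A _ _ = 0"

definition word_change ::
  "('t \<Rightarrow> real ^ 'n ^ 'n) \<Rightarrow> ('t, 'm, 'n) wrd \<Rightarrow> ('t, 'm, 'n) wrd \<Rightarrow> real" where
  "word_change A w w' = (if map fst w = map fst w'
     then \<Prod>r<length w. jet_change (A (fst (w ! r))) (snd (w ! r)) (snd (w' ! r)) else 0)"

definition changed :: "('t, 'p, 'm, 'n::finite) mono list \<Rightarrow> ('t \<Rightarrow> ('p, 'n) chart)
    \<Rightarrow> ('t \<Rightarrow> ('p, 'n) chart) \<Rightarrow> ('t \<Rightarrow> 'p) \<Rightarrow> ('t, 'm, 'n) wrd \<Rightarrow> real" where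
  "changed ms C C' X w' =
     (\<Sum>(u, w)\<leftarrow>ms. u C X * word_change (\<lambda>\<kappa>. jac (C \<kappa>) (C' \<kappa>) (X \<kappa>)) w w')"

definition covariant ::
  "('p, 'n::finite) chart set \<Rightarrow> 't set \<Rightarrow> ('t, 'p, 'm, 'n) mono list \<Rightarrow> bool" where
  "covariant atlas P ms \<longleftrightarrow>
    (\<forall>C C' X w. admissible atlas P C X \<and> admissible atlas P C' X \<longrightarrow>
       val ms C' X w = changed ms C C' X w)"


section \<open>Local functionals\<close>

text \<open>A local functional is a linear combination of bracketed products of integral functionals.
  A factor of such a product, and likewise the respective copy of the manifold, is labelled by its
  position in the binary tree of the bracketing. In \<open>FTerm r u P w\<close>, \<open>r\<close> is a number, \<open>u\<close> the
  coefficient, \<open>P\<close> the set of all factors (some of which may contribute no letter) and \<open>w\<close> the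
  product word.\<close>

datatype side = Lft | Rgt

type_synonym path = "side list"

datatype ('p, 'm, 'n) fterm = FTerm real "(path, 'p, 'n) coeff" "path set" "(path, 'm, 'n) wrd"

definition density :: "('p::topological_space, 'n::finite) chart set
    \<Rightarrow> (('p, 'n) chart \<Rightarrow> 'p \<Rightarrow> real) set
    \<Rightarrow> ((('p, 'n) chart \<Rightarrow> 'p \<Rightarrow> real) \<times> ('m, 'n) jet list) list \<Rightarrow> bool" where
  "density atlas S f \<longleftrightarrow> (\<forall>(u, w) \<in> set f. u \<in> S) \<and>
     covariant atlas {()} [(\<lambda>C X. u (C ()) (X ()), map (Pair ()) w). (u, w) \<leftarrow> f]"

definition integral_functional ::
  "((('p, 'n) chart \<Rightarrow> 'p \<Rightarrow> real) \<times> ('m, 'n) jet list) list \<Rightarrow> ('p, 'm, 'n) fterm list" where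
  "integral_functional f =
     [FTerm 1 (\<lambda>C X. u (C []) (X [])) {[]} (map (Pair []) w). (u, w) \<leftarrow> f]"

fun scale_term :: "real \<Rightarrow> ('p, 'm, 'n) fterm \<Rightarrow> ('p, 'm, 'n) fterm" where
  "scale_term s (FTerm r u P w) = FTerm (s * r) u P w"

fun times_term ::
  "('p, 'm, 'n) fterm \<Rightarrow> ('p, 'm, 'n) fterm \<Rightarrow> ('p, 'm, 'n) fterm list" where
  "times_term (FTerm r1 u1 P1 w1) (FTerm r2 u2 P2 w2) =
    (let v1 = map (apfst (Cons Lft)) w1; v2 = map (apfst (Cons Rgt)) w2;
         P = Cons Lft ` P1 \<union> Cons Rgt ` P2;
         u = (\<lambda>C X. u1 (\<lambda>\<alpha>. C (Lft # \<alpha>)) (\<lambda>\<alpha>. X (Lft # \<alpha>)) *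
                    u2 (\<lambda>\<alpha>. C (Rgt # \<alpha>)) (\<lambda>\<alpha>. X (Rgt # \<alpha>)))
     in if w1 = [] \<or> w2 = [] then [FTerm (r1 * r2) u P (v1 @ v2)]
        else [FTerm (r1 * r2 * s1 * s2 / (real (length w1) * real (length w2))) u P (x1 @ x2).
               (s1, x1) \<leftarrow> map (\<lambda>i. (rot ^^ i) (1, v1)) [0..<length w1],
               (s2, x2) \<leftarrow> map (\<lambda>j. (rot ^^ j) (1, v2)) [0..<length w2]])"

definition times_functional ::
  "('p, 'm, 'n) fterm list \<Rightarrow> ('p, 'm, 'n) fterm list \<Rightarrow> ('p, 'm, 'n) fterm list" where
  "times_functional F G = concat [times_term s t. s \<leftarrow> F, t \<leftarrow> G]"

inductive local_functional :: "('p::topological_space, 'n::finite) chart set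
    \<Rightarrow> (('p, 'n) chart \<Rightarrow> 'p \<Rightarrow> real) set \<Rightarrow> ('p, 'm::finite, 'n) fterm list \<Rightarrow> bool"
  for atlas and S where
  scalar: "local_functional atlas S [FTerm r (\<lambda>_ _. 1) {} []]"
| integral: "density atlas S f \<Longrightarrow> local_functional atlas S (integral_functional f)"
| times: "local_functional atlas S F \<Longrightarrow> local_functional atlas S G \<Longrightarrow>
    local_functional atlas S (times_functional F G)"
| sum: "local_functional atlas S F \<Longrightarrow> local_functional atlas S G \<Longrightarrow>
    local_functional atlas S (F @ G)"
| scale: "local_functional atlas S F \<Longrightarrow> local_functional atlas S (map (scale_term r) F)"

definition homogeneous :: "nat \<Rightarrow> ('p, 'm, 'n) fterm list \<Rightarrow> bool" where
  "homogeneous d F \<longleftrightarrow> (\<forall>r u P w. FTerm r u P w \<in> set F \<longrightarrow> wdeg w = d)"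


section \<open>The BV Laplacian and the Schouten bracket\<close>

text \<open>Multiplication comes first, then all the partial derivatives act, and the total derivatives
  and the restrictions to diagonals are performed at the very end. Hence partial derivatives
  produce terms \<open>DTerm r u P w \<pi> E\<close> in which these operations are still pending: \<open>\<pi>\<close> collects the
  operators $-D^{(\alpha)}_{x^k}$ to be applied to \<open>u w\<close>, and \<open>E\<close> contains the pairs of factors
  whose copies of the manifold are to be identified.\<close>

datatype ('p, 'm, 'n) dterm =
  DTerm real "(path, 'p, 'n) coeff" "path set" "(path, 'm, 'n) wrd"
    "(path \<times> 'n) multiset" "(path \<times> path) set"

fun no_pending :: "('p, 'm, 'n) fterm \<Rightarrow> ('p, 'm, 'n) dterm" where
  "no_pending (FTerm r u P w) = DTerm r u P w {#} {}"

definition delete_at :: "nat \<Rightarrow> 'a list \<Rightarrow> 'a list" where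
  "delete_at \<nu> w = take \<nu> w @ drop (Suc \<nu>) w"

text \<open>The part of the Laplacian with the even letter taken from the factors in \<open>A\<close> and the odd one
  from those in \<open>B\<close>. The sum over all letters of the deletions of that letter is the sum over all
  positions in the word; the odd letter is deleted first.\<close>

fun laplace_term ::
  "path set \<Rightarrow> path set \<Rightarrow> ('p, 'm, 'n) dterm \<Rightarrow> ('p, 'm, 'n) dterm list" where
  "laplace_term A B (DTerm r u P w \<pi> E) =
     [DTerm ((-1) ^ wdeg (take \<nu> w) * r) u P (delete_at \<mu> (delete_at \<nu> w))
        (\<pi> + image_mset (Pair \<alpha>) \<sigma> + image_mset (Pair \<beta>) \<tau>) (insert (\<alpha>, \<beta>) E).
       (\<nu>, (\<beta>, Odd i \<tau>)) \<leftarrow> List.enumerate 0 w, \<beta> \<in> B,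
       (\<mu>, (\<alpha>, Even j \<sigma>)) \<leftarrow> List.enumerate 0 (delete_at \<nu> w), \<alpha> \<in> A \<and> j = i]"

definition laplace_part ::
  "path set \<Rightarrow> path set \<Rightarrow> ('p, 'm, 'n) dterm list \<Rightarrow> ('p, 'm, 'n) dterm list" where
  "laplace_part A B Y = concat (map (laplace_term A B) Y)"

text \<open>Multiplication by $(-1)^{n\cdot d}$, where \<open>d\<close> is the number of odd letters from \<open>A\<close>.\<close>

fun sign_term :: "nat \<Rightarrow> path set \<Rightarrow> ('p, 'm, 'n) dterm \<Rightarrow> ('p, 'm, 'n) dterm" where
  "sign_term n A (DTerm r u P w \<pi> E) = DTerm ((-1) ^ (n * odd_count A w) * r) u P w \<pi> E"

text \<open>Since the operators do not act on the functionals but on the word of their product, composed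
  expressions are treated syntactically.\<close>

datatype ('p, 'm, 'n) expr =
    Loc "('p, 'm, 'n) fterm list"
  | Times "('p, 'm, 'n) expr" "('p, 'm, 'n) expr"
  | Laplace "('p, 'm, 'n) expr"  (\<open>\<Delta>\<close>)
  | Schouten "('p, 'm, 'n) expr" "('p, 'm, 'n) expr"  (\<open>\<lbrakk>_,/ _\<rbrakk>\<^sub>S\<close>)

fun product_word :: "('p, 'm, 'n) expr \<Rightarrow> ('p, 'm, 'n) fterm list" where
  "product_word (Loc F) = F"
| "product_word (Times e e') = times_functional (product_word e) (product_word e')"
| "product_word (Laplace e) = product_word e"
| "product_word (Schouten e e') = times_functional (product_word e) (product_word e')"

text \<open>The Laplacian and the bracket are odd operators.\<close>

fun op_count :: "('p, 'm, 'n) expr \<Rightarrow> nat" where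
  "op_count (Loc F) = 0"
| "op_count (Times e e') = op_count e + op_count e'"
| "op_count (Laplace e) = Suc (op_count e)"
| "op_count (Schouten e e') = Suc (op_count e + op_count e')"

definition below :: "path \<Rightarrow> path set" where
  "below q = {q @ \<alpha> |\<alpha>. True}"

text \<open>\<open>act q e\<close> applies the operators in \<open>e\<close> to a product word in which the factors of \<open>e\<close> are those
  in \<open>below q\<close>. The operators in the second argument of a product or a bracket pass through
  the first one. Apart from the sign $(-1)^{|F|}$, the bracket is the part of the Laplacian
  in which the deleted letters come from different arguments; see \<open>Laplace_Times\<close> below.\<close>

fun act :: "path \<Rightarrow> ('p, 'm, 'n) expr \<Rightarrow> ('p, 'm, 'n) dterm list \<Rightarrow> ('p, 'm, 'n) dterm list"
where
  "act q (Loc F) Y = Y"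
| "act q (Times e e') Y =
     act (q @ [Lft]) e (act (q @ [Rgt]) e' (map (sign_term (op_count e') (below (q @ [Lft]))) Y))"
| "act q (Laplace e) Y = laplace_part (below q) (below q) (act q e Y)"
| "act q (Schouten e e') Y =
     (let Z = map (sign_term 1 (below (q @ [Lft])))
            (act (q @ [Lft]) e
              (act (q @ [Rgt]) e' (map (sign_term (op_count e') (below (q @ [Lft]))) Y)))
      in laplace_part (below (q @ [Lft])) (below (q @ [Rgt])) Z @
         laplace_part (below (q @ [Rgt])) (below (q @ [Lft])) Z)"

text \<open>The copies of the manifold after the identifications are labelled by sets of factors.\<close>

definition glued :: "path set \<Rightarrow> (path \<times> path) set \<Rightarrow> path \<Rightarrow> path set" where
  "glued P E \<alpha> = {\<beta> \<in> P. (\<alpha>, \<beta>) \<in> (E \<union> E\<inverse>)\<^sup>*}"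

text \<open>The total derivatives commute on smooth coefficients, so their order is immaterial.\<close>

fun resolve :: "('p, 'm, 'n::finite) dterm \<Rightarrow> (path set, 'p, 'm, 'n) mono list" where
  "resolve (DTerm r u P w \<pi> E) = map (\<lambda>(u, w).
       (\<lambda>C X. r * (-1) ^ size \<pi> * u (C \<circ> glued P E) (X \<circ> glued P E), map (apfst (glued P E)) w))
     (total_derivs (SOME ds. mset ds = \<pi>) (u, w))"

fun base :: "('p, 'm, 'n) dterm \<Rightarrow> path set set" where
  "base (DTerm r u P w \<pi> E) = glued P E ` P"

text \<open>The density of an expression: for each set \<open>Q\<close> of copies of the manifold, the
  coefficients of the words over the product of these copies.\<close>

type_synonym ('p, 'm, 'n) multi_density =
  "path set set \<Rightarrow> (path set \<Rightarrow> ('p, 'n) chart) \<Rightarrow> (path set \<Rightarrow> 'p)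
    \<Rightarrow> (path set, 'm, 'n) wrd \<Rightarrow> real"

definition evaluate :: "('p, 'm, 'n::finite) expr \<Rightarrow> ('p, 'm, 'n) multi_density" where
  "evaluate e Q C X w =
     (\<Sum>t\<leftarrow>act [] e (map no_pending (product_word e)).
        if base t = Q then val (resolve t) C X w else 0)"


subsection \<open>The bracket as the failure of the Laplacian to be a derivation\<close>

lemma sum_concat_map:
  fixes f :: "_ \<Rightarrow> real"
  shows "sum_list (map f (concat (map g xs))) = (\<Sum>x\<leftarrow>xs. sum_list (map f (g x)))"
  by (induction xs) auto

lemma laplace_sum:
  fixes f :: "('p, 'm, 'n) dterm \<Rightarrow> real"
  shows "(\<Sum>t\<leftarrow>laplace_term A B (DTerm r u P w \<pi> E). f t) =
    (\<Sum>x\<leftarrow>List.enumerate 0 w. \<Sum>z\<leftarrow>List.enumerate 0 (delete_at (fst x) w).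
      case (snd (snd x), snd (snd z)) of (Odd i \<tau>, Even j \<sigma>) \<Rightarrow>
        if fst (snd x) \<in> B \<and> fst (snd z) \<in> A \<and> j = i then
        f (DTerm ((-1) ^ wdeg (take (fst x) w) * r) u P (delete_at (fst z) (delete_at (fst x) w))
        (\<pi> + image_mset (Pair (fst (snd z))) \<sigma> + image_mset (Pair (fst (snd x))) \<tau>)
          (insert (fst (snd z), fst (snd x)) E)) else 0
      | _ \<Rightarrow> 0)"
proof -
  have *: "sum_list (map f xs) = sum_list (map g xs)" if "\<And>x. f x = g x" for f g :: "_ \<Rightarrow> real" and xs
    using that by presburger
  have zero: "sum_list (map f xs) = 0" if "\<And>x. f x = 0" for f :: "_ \<Rightarrow> real" and xs
    using that by (induction xs) auto
  show ?thesis
    unfolding laplace_term.simps sum_concat_map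
    apply (rule *)
    subgoal for x
      apply (cases x; cases "snd (snd x)")
      subgoal by simp
      subgoal for i \<tau>
        apply (cases "fst (snd x) \<in> B")
        subgoal by (auto simp: sum_concat_map split: jet.splits intro!: *)
        subgoal by (auto simp: zero split: jet.splits)
        done
      done
    done
qed

lemma laplace_split:
  fixes f :: "('p, 'm, 'n) dterm \<Rightarrow> real"
  assumes w: "\<forall>l \<in> set w. fst l \<in> A \<union> B" and "A \<inter> B = {}"
  shows "(\<Sum>t\<leftarrow>laplace_term UNIV UNIV (DTerm r u P w \<pi> E). f t) =
    (\<Sum>t\<leftarrow>laplace_term A A (DTerm r u P w \<pi> E). f t) + (\<Sum>t\<leftarrow>laplace_term B B (DTerm r u P w \<pi> E). f t)
    + (\<Sum>t\<leftarrow>laplace_term A B (DTerm r u P w \<pi> E). f t) + (\<Sum>t\<leftarrow>laplace_term B A (DTerm r u P w \<pi> E). f t)"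
proof -
  have 1: "set (delete_at \<nu> w) \<subseteq> set w" for \<nu>
    by (auto simp: delete_at_def dest: in_set_takeD in_set_dropD)
  have 2: "fst (snd x) \<in> A \<union> B" if "x \<in> set (List.enumerate 0 w)" for x
    using w that nth_mem[of "fst x" w] by (cases x) (auto simp: in_set_enumerate_eq)
  have 3: "fst (snd x) \<in> A \<union> B" if "x \<in> set (List.enumerate 0 (delete_at \<nu> w))" for x \<nu>
    using w that 1[of \<nu>] nth_mem[of "fst x" "delete_at \<nu> w"] by (cases x) (fastforce simp: in_set_enumerate_eq)
  show ?thesis
    unfolding laplace_sum sum_list_addf[symmetric]
    apply (rule arg_cong[where f=sum_list], rule map_cong[OF refl])
    apply (rule arg_cong[where f=sum_list], rule map_cong[OF refl])
    apply (drule 2, drule 3)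
    using assms(2)
    apply (auto split: jet.splits)
    done
qed

lemma odd_count_simps: "odd_count A [] = 0" "odd_count A (x # w) = of_bool (fst x \<in> A \<and> is_odd (snd x)) + odd_count A w"
  "odd_count A (v @ w) = odd_count A v + odd_count A w"
  by (auto simp: odd_count_def case_prod_unfold)

lemma rot_set: "set (snd (rot y)) = set (snd y) \<and> odd_count A (snd (rot y)) = odd_count A (snd y)"
proof (cases "snd y" rule: rev_cases)
  case (snoc v x)
  then show ?thesis by (cases y) (auto simp: odd_count_simps)
qed (cases y, auto)

lemma rot_pow: "set (snd ((rot ^^ i) y)) = set (snd y) \<and> odd_count A (snd ((rot ^^ i) y)) = odd_count A (snd y)"
  by (induction i) (simp_all add: rot_set del: rot.simps)

lemma below_Cons: "\<alpha> \<in> below [s] \<longleftrightarrow> (\<exists>\<beta>. \<alpha> = s # \<beta>)"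
  by (auto simp: below_def)

lemma map_tag: "odd_count (below [s]) (map (apfst (Cons s')) w) = (if s = s' then wdeg w else 0)"
  by (induction w) (auto simp: odd_count_simps below_Cons)

lemma map_tag_set: "fst ` set (map (apfst (Cons s)) w) \<subseteq> below [s]"
  by (auto simp: below_Cons)

lemma times_term_word:
  assumes "FTerm r u P w \<in> set (times_term (FTerm r1 u1 P1 w1) (FTerm r2 u2 P2 w2))"
  shows "fst ` set w \<subseteq> below [Lft] \<union> below [Rgt] \<and> odd_count (below [Lft]) w = wdeg w1"
proof -
  let ?v1 = "map (apfst (Cons Lft)) w1" and ?v2 = "map (apfst (Cons Rgt)) w2"
  obtain i j where w: "w = snd ((rot ^^ i) (1, ?v1)) @ snd ((rot ^^ j) (1, ?v2))"
  proof (cases "w1 = [] \<or> w2 = []")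
    case True
    then show ?thesis
      using assms that[of 0 0] by (auto simp: Let_def)
  next
    case False
    then have "\<exists>i j. w = snd ((rot ^^ i) (1, ?v1)) @ snd ((rot ^^ j) (1, ?v2))"
      using assms by (simp add: Let_def case_prod_unfold del: rot.simps) blast
    then show ?thesis
      using that by blast
  qed
  show ?thesis
    using rot_pow[of i "(1, ?v1)" "below [Lft]"] rot_pow[of j "(1, ?v2)" "below [Lft]"]
      map_tag_set[of Lft w1] map_tag_set[of Rgt w2]
    unfolding w by (auto simp: odd_count_simps map_tag below_Cons)
qed

lemma evaluate_scale: "(if base (DTerm (s * r) u P v \<pi> E) = Q then val (resolve (DTerm (s * r) u P v \<pi> E)) C X w else 0) =
   s * (if base (DTerm r u P v \<pi> E) = Q then val (resolve (DTerm r u P v \<pi> E)) C X w else 0)"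
proof -
  have "val (map (\<lambda>(u, v). (\<lambda>C X. s * r * a * u (h C) (k X), l v)) ms) C X w =
        s * val (map (\<lambda>(u, v). (\<lambda>C X. r * a * u (h C) (k X), l v)) ms) C X w"
    for ms :: "(path, 'a, 'b, 'c) mono list" and a h k l
    by (induction ms) (auto simp: val_def algebra_simps)
  from this[of "(-1) ^ size \<pi>" "\<lambda>C. C \<circ> glued P E" "\<lambda>X. X \<circ> glued P E"]
  show ?thesis by (simp del: map_map)
qed

lemma laplace_scale_gen:
  fixes f :: "('p, 'm, 'n) dterm \<Rightarrow> real"
  assumes f: "\<And>r u P v \<pi> E. f (DTerm (s * r) u P v \<pi> E) = s * f (DTerm r u P v \<pi> E)"
  shows "(\<Sum>t\<leftarrow>laplace_term A B (DTerm (s * r) u P v \<pi> E). f t) =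
   s * (\<Sum>t\<leftarrow>laplace_term A B (DTerm r u P v \<pi> E). f t)"
  unfolding laplace_sum sum_list_const_mult[symmetric]
  apply (rule arg_cong[where f=sum_list], rule map_cong[OF refl])
  apply (rule arg_cong[where f=sum_list], rule map_cong[OF refl])
  by (auto split: jet.splits simp: mult.left_commute[of _ s] f)

lemma laplace_scale:
  "(\<Sum>t\<leftarrow>laplace_term A B (DTerm (s * r) u P v \<pi> E). if base t = Q then val (resolve t) C X w else 0) =
   s * (\<Sum>t\<leftarrow>laplace_term A B (DTerm r u P v \<pi> E). if base t = Q then val (resolve t) C X w else 0)"
  by (rule laplace_scale_gen) (rule evaluate_scale)

lemma Laplace_Times:
  assumes F: "homogeneous d F"
  shows "evaluate (\<Delta> (Times (Loc F) (Loc G))) Q C X w =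
    evaluate (Times (\<Delta> (Loc F)) (Loc G)) Q C X w
    + (-1) ^ d * evaluate \<lbrakk>Loc F, Loc G\<rbrakk>\<^sub>S Q C X w
    + (-1) ^ d * evaluate (Times (Loc F) (\<Delta> (Loc G))) Q C X w"
proof -
  let ?L = "below [Lft]" and ?R = "below [Rgt]"
  let ?f = "\<lambda>t. if base t = Q then val (resolve t) C X w else 0"
  define W where "W = map no_pending (times_functional F G)"
  have W: "\<exists>r u P v. y = DTerm r u P v {#} {} \<and> (\<forall>l\<in>set v. fst l \<in> ?L \<union> ?R) \<and> odd_count ?L v = d"
    if y: "y \<in> set W" for y
  proof -
    obtain s t z where z: "s \<in> set F" "z \<in> set (times_term s t)" "y = no_pending z"
      using y by (auto simp: W_def times_functional_def)
    obtain r1 u1 P1 w1 r2 u2 P2 w2 r u P v where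
      eqs: "s = FTerm r1 u1 P1 w1" "t = FTerm r2 u2 P2 w2" "z = FTerm r u P v"
      using fterm.exhaust by metis
    have "wdeg w1 = d"
      using F z(1) eqs(1) by (auto simp: homogeneous_def)
    moreover have "fst ` set v \<subseteq> ?L \<union> ?R \<and> odd_count ?L v = wdeg w1"
      using times_term_word z(2) unfolding eqs .
    ultimately show ?thesis
      using z(3) eqs(3) by auto
  qed
  have univ: "below [] = UNIV" by (auto simp: below_def)
  have disj: "?L \<inter> ?R = {}" by (auto simp: below_def)
  have sign0: "sign_term 0 A t = t" for A t by (cases t) simp
  have lp: "(\<Sum>t\<leftarrow>laplace_part A B Y. ?f t) = (\<Sum>y\<leftarrow>Y. \<Sum>t\<leftarrow>laplace_term A B y. ?f t)" for A B Y
    by (simp add: laplace_part_def sum_concat_map)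
  have sgn: "(\<Sum>y\<leftarrow>map (sign_term 1 ?L) W. \<Sum>t\<leftarrow>laplace_term A B y. ?f t) =
      (-1) ^ d * (\<Sum>y\<leftarrow>W. \<Sum>t\<leftarrow>laplace_term A B y. ?f t)" for A B
  proof -
    have "(\<Sum>t\<leftarrow>laplace_term A B (sign_term 1 ?L y). ?f t) =
        (-1) ^ d * (\<Sum>t\<leftarrow>laplace_term A B y. ?f t)" if y: "y \<in> set W" for y
    proof -
      obtain r u P v where y: "y = DTerm r u P v {#} {}" and d: "odd_count ?L v = d"
        using W[OF y] by blast
      show ?thesis
        unfolding y sign_term.simps mult_1 d by (rule laplace_scale)
    qed
    then have "(\<Sum>y\<leftarrow>W. \<Sum>t\<leftarrow>laplace_term A B (sign_term 1 ?L y). ?f t) =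
        (\<Sum>y\<leftarrow>W. (-1) ^ d * (\<Sum>t\<leftarrow>laplace_term A B y. ?f t))"
      by (intro arg_cong[where f=sum_list] map_cong refl)
    then show ?thesis
      by (simp only: map_map o_def sum_list_const_mult)
  qed
  have split: "(\<Sum>y\<leftarrow>W. \<Sum>t\<leftarrow>laplace_term UNIV UNIV y. ?f t) =
     (\<Sum>y\<leftarrow>W. \<Sum>t\<leftarrow>laplace_term ?L ?L y. ?f t) + (\<Sum>y\<leftarrow>W. \<Sum>t\<leftarrow>laplace_term ?R ?R y. ?f t)
    + (\<Sum>y\<leftarrow>W. \<Sum>t\<leftarrow>laplace_term ?L ?R y. ?f t) + (\<Sum>y\<leftarrow>W. \<Sum>t\<leftarrow>laplace_term ?R ?L y. ?f t)"
    unfolding sum_list_addf[symmetric]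
    apply (rule arg_cong[where f=sum_list], rule map_cong[OF refl])
    apply (drule W) using laplace_split[OF _ disj] by fast
  have m: "(-1) ^ d * ((-1) ^ d * x) = x" for x :: real
    by (simp add: mult.assoc[symmetric] power_add[symmetric])
  show ?thesis
    unfolding evaluate_def product_word.simps W_def[symmetric] act.simps op_count.simps Let_def
      univ append_Nil sign0 list.map_ident map_append sum_list_append lp split
    using sgn by (simp add: sign0 distrib_left m)
qed


section \<open>Integration by parts\<close>

text \<open>A current \<open>J\<close> has for every copy \<open>\<kappa>\<close> the components of a vector field along \<open>\<kappa>\<close>.\<close>

definition current :: "('p::topological_space, 'n::finite) chart set
    \<Rightarrow> (('p, 'n) chart \<Rightarrow> 'p \<Rightarrow> real) set \<Rightarrow> 't set
    \<Rightarrow> ('t \<Rightarrow> 'n \<Rightarrow> ('t, 'p, 'm, 'n) mono list) \<Rightarrow> bool" where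
  "current atlas S Q J \<longleftrightarrow>
    (\<forall>\<kappa>\<in>Q. \<forall>k. \<forall>(u, w) \<in> set (J \<kappa> k). fst ` set w \<subseteq> Q \<and> smooth_coeff atlas Q u \<and>
       (\<forall>C X. admissible atlas Q C X \<longrightarrow>
         (\<forall>\<kappa>'\<in>Q. (\<lambda>c p. u (C(\<kappa>' := c)) (X(\<kappa>' := p))) \<in> S))) \<and>
    (\<forall>\<kappa>\<in>Q. \<forall>C C' X w l. admissible atlas Q C X \<and> admissible atlas Q C' X \<longrightarrow>
       val (J \<kappa> l) C' X w =
         (\<Sum>k\<in>UNIV. jac (C \<kappa>) (C' \<kappa>) (X \<kappa>) $ l $ k * changed (J \<kappa> k) C C' X w))"

text \<open>The divergence with respect to the volume element.\<close>

definition divergence :: "(('p, 'n::finite) chart \<Rightarrow> 'p \<Rightarrow> real) \<Rightarrow> 't set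
    \<Rightarrow> ('t \<Rightarrow> 'n \<Rightarrow> ('t, 'p, 'm, 'n) mono list)
    \<Rightarrow> ('t \<Rightarrow> ('p, 'n) chart) \<Rightarrow> ('t \<Rightarrow> 'p) \<Rightarrow> ('t, 'm, 'n) wrd \<Rightarrow> real" where
  "divergence vol Q J C X w =
    (\<Sum>\<kappa>\<in>Q. \<Sum>k\<in>UNIV. val (concat (map (total_deriv \<kappa> k)
        (map (\<lambda>(u, v). (\<lambda>C X. vol (C \<kappa>) (X \<kappa>) * u C X, v)) (J \<kappa> k)))) C X w / vol (C \<kappa>) (X \<kappa>))"

text \<open>Two densities define the same functional iff, as cyclic words, they differ by
  total divergences.\<close>

definition same_functional :: "('p::topological_space, 'n::finite) chart set
    \<Rightarrow> (('p, 'n) chart \<Rightarrow> 'p \<Rightarrow> real) \<Rightarrow> (('p, 'n) chart \<Rightarrow> 'p \<Rightarrow> real) set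
    \<Rightarrow> ('p, 'm, 'n) multi_density \<Rightarrow> ('p, 'm, 'n) multi_density \<Rightarrow> bool" where
  "same_functional atlas vol S H H' \<longleftrightarrow>
    (\<forall>Q. \<exists>J. current atlas S Q J \<and>
      (\<forall>C X. admissible atlas Q C X \<longrightarrow>
        cyclic_null (\<lambda>w. H Q C X w - H' Q C X w - divergence vol Q J C X w)))"

end

theory Submission
  imports Defs
begin

text \<open>Because every total derivative and every restriction to a diagonal is postponed to the end, the
  composite operators are nothing but sums over the ways to delete two odd and two even letters
  from one word. Left derivatives by letters commute in the graded sense
  (\<open>deletion_sum_swap\<close>), and a summand of the Laplacian deletes exactly one odd letter, so it is
  odd. The pending operations form a multiset and a set and hence do not remember in which order
  the pairs were deleted. Therefore any two parts of the Laplacian, specified by the factors which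
  the letters come from, anticommute (\<open>laplace_term_anticommute\<close>).

  Write $\Delta_{AB}$ for the part whose even letter comes from \<open>A\<close> and whose odd letter comes
  from \<open>B\<close>. On the product word of $F$ and $G$, the Laplacian is
  $\Delta = \Delta_{FF} + \Delta_{GG} + \beta$ with $\beta = \Delta_{FG} + \Delta_{GF}$, and the
  bracket is $(-1)^{|F|}\beta$. By anticommutation $\beta\beta = 0$, so that
  $\Delta\beta = -\beta\Delta_{FF} - \beta\Delta_{GG}$. Multiplied by $(-1)^{|F|}$, the first term
  is the bracket of $\Delta F$ with $G$, as $|\Delta F| = |F| - 1$. The second term is
  $(-1)^{|F|-1}$ times the bracket of $F$ with $\Delta G$: there the sign of the bracket cancels
  the one that $\Delta$ acquires by passing through $F$.

  The argument is an identity of words and coefficients (\<open>Laplace_Schouten\<close>). So the densities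
  on the two sides are equal, and a fortiori they define the same functional.\<close>


section \<open>Graded deletion of letters\<close>

definition koszul :: "'t \<times> ('m, 'n) jet \<Rightarrow> 't \<times> ('m, 'n) jet \<Rightarrow> real" where
  "koszul l m = (if is_odd (snd l) \<and> is_odd (snd m) then -1 else 1)"

text \<open>The graded left derivatives with respect to all letters at once. The continuation \<open>f\<close> allows repeated
  deletion to be written by nesting. The recursion on the word lets identities be proved by
  induction, where sums over positions would require positions to be shifted after each deletion.\<close>

primrec deletion_sum :: "('t, 'm, 'n) wrd \<Rightarrow>
    ('t \<times> ('m, 'n) jet \<Rightarrow> ('t, 'm, 'n) wrd \<Rightarrow> real) \<Rightarrow> real" where
  "deletion_sum [] f = 0"
| "deletion_sum (x # w) f = f x w + deletion_sum w (\<lambda>l v. koszul x l * f l (x # v))"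

lemma koszul_commute: "koszul l m = koszul m l"
  by (auto simp: koszul_def)

lemma koszul_square: "koszul l m * (koszul l m * c) = c"
  by (auto simp: koszul_def)

lemma deletion_sum_add:
  "deletion_sum w (\<lambda>l v. f l v + g l v) = deletion_sum w f + deletion_sum w g"
  by (induction w arbitrary: f g) (simp_all add: distrib_left)

lemma deletion_sum_mult: "deletion_sum w (\<lambda>l v. c * f l v) = c * deletion_sum w f"
  by (induction w arbitrary: f) (simp_all add: distrib_left mult.left_commute[of _ c])

lemma deletion_sum_eq_sum:
  "deletion_sum w f = (\<Sum>x\<leftarrow>List.enumerate 0 w.
     (if is_odd (snd (snd x)) then (-1) ^ wdeg (take (fst x) w) else 1) *
       f (snd x) (delete_at (fst x) w))"
proof (induction w arbitrary: f)
  case (Cons y w)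
  have "deletion_sum (y # w) f = f y w + (\<Sum>x\<leftarrow>List.enumerate 0 w.
     (if is_odd (snd (snd x)) then (-1) ^ wdeg (take (fst x) w) else 1) *
       (koszul y (snd x) * f (snd x) (y # delete_at (fst x) w)))"
    by (simp add: Cons.IH)
  also have "(\<Sum>x\<leftarrow>List.enumerate 0 w.
       (if is_odd (snd (snd x)) then (-1) ^ wdeg (take (fst x) w) else 1) *
         (koszul y (snd x) * f (snd x) (y # delete_at (fst x) w))) =
     (\<Sum>x\<leftarrow>List.enumerate (Suc 0) w.
     (if is_odd (snd (snd x)) then (-1) ^ wdeg (take (fst x) (y # w)) else 1) *
       f (snd x) (delete_at (fst x) (y # w)))"
    by (auto simp: enumerate_Suc_eq[of 0] o_def koszul_def odd_count_simps delete_at_def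
        intro!: arg_cong[where f=sum_list])
  finally show ?case
    by (simp add: delete_at_def odd_count_simps)
qed simp

text \<open>Left derivatives commute up to the Koszul sign. In the induction step, the summands in which the
  first letter of the word is deleted first and those in which it is deleted second exchange
  their roles.\<close>

lemma deletion_sum_swap:
  "deletion_sum w (\<lambda>l v. deletion_sum v (f l)) =
   deletion_sum w (\<lambda>l v. deletion_sum v (\<lambda>m v. koszul l m * f m l v))"
proof (induction w arbitrary: f)
  case (Cons x w)
  have expand: "deletion_sum (x # w) (\<lambda>l v. deletion_sum v (g l)) =
      deletion_sum w (g x) + deletion_sum w (\<lambda>l v. koszul x l * g l x v) +
      deletion_sum w (\<lambda>l v. deletion_sum v (\<lambda>m v. koszul x l * (koszul x m * g l m (x # v))))" for g
    by (simp add: distrib_left deletion_sum_add deletion_sum_mult)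
  show ?case
    unfolding expand Cons.IH[of "\<lambda>l m v. koszul x l * (koszul x m * f l m (x # v))"]
    by (simp add: koszul_commute[of _ x] koszul_square mult_ac)
qed simp

text \<open>The pair \<open>(l', m')\<close> moves past the pair \<open>(l, m)\<close> by four transpositions of neighbours.\<close>

lemma deletion_sum_swap_pairs:
  "deletion_sum w (\<lambda>l v. deletion_sum v (\<lambda>m v. deletion_sum v (\<lambda>l' v. deletion_sum v (f l m l')))) =
   deletion_sum w (\<lambda>l v. deletion_sum v (\<lambda>m v. deletion_sum v (\<lambda>l' v. deletion_sum v (\<lambda>m' v.
     koszul l l' * koszul l m' * koszul m l' * koszul m m' * f l' m' l m v))))"
  (is "?lhs = ?rhs")
proof -
  have "?lhs = deletion_sum w (\<lambda>l v. deletion_sum v (\<lambda>l' v. deletion_sum v (\<lambda>m v. deletion_sum v (\<lambda>m' v.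
      koszul l' m * f l m l' m' v))))"
    by (subst deletion_sum_swap) (simp add: deletion_sum_mult)
  also have "\<dots> = deletion_sum w (\<lambda>l' v. deletion_sum v (\<lambda>l v. deletion_sum v (\<lambda>m v. deletion_sum v (\<lambda>m' v.
      koszul l' l * koszul l' m * f l m l' m' v))))"
    by (subst deletion_sum_swap) (simp add: deletion_sum_mult mult.assoc)
  also have "\<dots> = deletion_sum w (\<lambda>l' v. deletion_sum v (\<lambda>l v. deletion_sum v (\<lambda>m' v. deletion_sum v (\<lambda>m v.
      koszul m' m * koszul l' l * koszul l' m * f l m l' m' v))))"
    by (subst deletion_sum_swap) (simp add: deletion_sum_mult mult.assoc)
  also have "\<dots> = deletion_sum w (\<lambda>l' v. deletion_sum v (\<lambda>m' v. deletion_sum v (\<lambda>l v. deletion_sum v (\<lambda>m v.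
      koszul m' l * koszul m' m * koszul l' l * koszul l' m * f l m l' m' v))))"
    by (subst deletion_sum_swap) (simp add: deletion_sum_mult mult.assoc)
  finally show ?thesis
    by (simp add: mult_ac)
qed

section \<open>Anticommutation of the parts of the Laplacian\<close>

text \<open>The condition under which the Laplacian deletes its two arguments, the odd letter being the
  first.\<close>

fun pairing :: "'t set \<Rightarrow> 't set \<Rightarrow> 't \<times> ('m, 'n) jet \<Rightarrow> 't \<times> ('m, 'n) jet \<Rightarrow> real" where
  "pairing A B (\<beta>, Odd i \<tau>) (\<alpha>, Even j \<sigma>) = of_bool (\<beta> \<in> B \<and> \<alpha> \<in> A \<and> j = i)"
| "pairing A B _ _ = 0"

fun pending :: "'t \<times> ('m, 'n) jet \<Rightarrow> ('t \<times> 'n) multiset" where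
  "pending (\<alpha>, Even i \<sigma>) = image_mset (Pair \<alpha>) \<sigma>"
| "pending (\<alpha>, Odd i \<sigma>) = image_mset (Pair \<alpha>) \<sigma>"

text \<open>Signs sit in the numerical factor of a term, whereas \<open>deletion_sum\<close> puts them in front of the
  value. Homogeneity in this factor is what allows one to pass between the two; evaluation has it,
  and it persists when a part of the Laplacian is applied first.\<close>

definition scaling :: "(('p, 'm, 'n) dterm \<Rightarrow> real) \<Rightarrow> bool" where
  "scaling f \<longleftrightarrow> (\<forall>s r u P w \<pi> E. f (DTerm (s * r) u P w \<pi> E) = s * f (DTerm r u P w \<pi> E))"

lemma scaling_laplace:
  assumes "scaling f"
  shows "scaling (\<lambda>t. \<Sum>t'\<leftarrow>laplace_term A B t. f t')"
  using assms unfolding scaling_def by (intro allI laplace_scale_gen) blast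

text \<open>The Laplacian has a sign for the odd letter only, which agrees with the Koszul sign because
  moving an even letter costs none.\<close>

lemma laplace_term_eq_deletion_sum:
  assumes "scaling f"
  shows "(\<Sum>t\<leftarrow>laplace_term A B (DTerm r u P w \<pi> E). f t) =
    deletion_sum w (\<lambda>l v. deletion_sum v (\<lambda>m v. pairing A B l m *
      f (DTerm r u P v (\<pi> + pending m + pending l) (insert (fst m, fst l) E))))"
  unfolding laplace_sum deletion_sum_eq_sum sum_list_const_mult[symmetric]
  apply (rule arg_cong[where f=sum_list], rule map_cong[OF refl])
  apply (rule arg_cong[where f=sum_list], rule map_cong[OF refl])
  using assms[unfolded scaling_def]
  by (auto split: jet.splits)

text \<open>Both orders delete the same pairs and leave the same word with the same pending operations.
  Exchanging the pairs costs the product of four Koszul signs, and the only one equal to $-1$ is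
  that of the two odd letters.\<close>

lemma laplace_term_anticommute:
  fixes f :: "('p, 'm, 'n) dterm \<Rightarrow> real"
  assumes f: "scaling f"
  shows "(\<Sum>t\<leftarrow>laplace_term A B y. \<Sum>t'\<leftarrow>laplace_term C D t. f t') =
    - (\<Sum>t\<leftarrow>laplace_term C D y. \<Sum>t'\<leftarrow>laplace_term A B t. f t')"
proof (cases y)
  case (DTerm r u P w \<pi> E)
  define h where "h A B C D l m l' m' v = pairing A B l m * (pairing C D l' m' *
      f (DTerm r u P v (\<pi> + pending m + pending l + pending m' + pending l')
        (insert (fst m', fst l') (insert (fst m, fst l) E))))"
    for A B C D m m' and l l' :: "path \<times> ('m, 'n) jet" and v :: "(path, 'm, 'n) wrd"
  have twice: "(\<Sum>t\<leftarrow>laplace_term A B y. \<Sum>t'\<leftarrow>laplace_term C D t. f t') =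
    deletion_sum w (\<lambda>l v. deletion_sum v (\<lambda>m v. deletion_sum v (\<lambda>l' v. deletion_sum v (h A B C D l m l'))))"
    for A B C D
    unfolding DTerm laplace_term_eq_deletion_sum[OF scaling_laplace[OF f]]
      laplace_term_eq_deletion_sum[OF f] h_def[abs_def]
    by (simp only: deletion_sum_mult)
  have swap: "koszul l l' * koszul l m' * koszul m l' * koszul m m' * h A B C D l' m' l m v =
      - 1 * h C D A B l m l' m' v" for l m l' m' v
  proof (cases "pairing A B l' m' = 0 \<or> pairing C D l m = 0")
    case False
    then have "is_odd (snd l) \<and> \<not> is_odd (snd m) \<and> is_odd (snd l') \<and> \<not> is_odd (snd m')"
      by (cases "(A, B, l', m')" rule: pairing.cases; cases "(C, D, l, m)" rule: pairing.cases) auto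
    then show ?thesis
      by (simp add: koszul_def h_def insert_commute add_ac)
  qed (auto simp: h_def)
  show ?thesis
    unfolding twice[of A B C D] deletion_sum_swap_pairs[of w "h A B C D"] swap deletion_sum_mult twice
    by simp
qed

section \<open>The words that remain\<close>

lemma odd_count_delete_at:
  assumes "\<nu> < length w"
  shows "odd_count K (delete_at \<nu> w) + of_bool (fst (w ! \<nu>) \<in> K \<and> is_odd (snd (w ! \<nu>))) =
    odd_count K w"
  by (subst (2) id_take_nth_drop[OF assms]) (simp add: delete_at_def odd_count_simps)

lemma set_delete_at: "set (delete_at \<nu> w) \<subseteq> set w"
  by (auto simp: delete_at_def dest: in_set_takeD in_set_dropD)

text \<open>Two consequences are needed: no letter from other factors appears, so the Laplacian can be split
  again on the result, and the degree drops by one in the factor that \<open>\<beta>\<close> belongs to and nowhere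
  else, which governs the sign of a subsequent bracket.\<close>

lemma laplace_term_result:
  assumes "t \<in> set (laplace_term A B (DTerm r u P w \<pi> E))"
  obtains r' v \<pi>' E' \<beta> where "t = DTerm r' u P v \<pi>' E'" "set v \<subseteq> set w" "\<beta> \<in> B"
    "\<And>K. odd_count K v + of_bool (\<beta> \<in> K) = odd_count K w"
proof -
  obtain \<nu> \<beta> i \<tau> \<mu> \<alpha> \<sigma> r' \<pi>' E' where *:
    "(\<nu>, (\<beta>, Odd i \<tau>)) \<in> set (List.enumerate 0 w)" "\<beta> \<in> B"
    "(\<mu>, (\<alpha>, Even i \<sigma>)) \<in> set (List.enumerate 0 (delete_at \<nu> w))"
    "t = DTerm r' u P (delete_at \<mu> (delete_at \<nu> w)) \<pi>' E'"
    using assms by (auto split: jet.splits if_splits)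
  have "odd_count K (delete_at \<mu> (delete_at \<nu> w)) + of_bool (\<beta> \<in> K) = odd_count K w" for K
    using odd_count_delete_at[of \<nu> w K] odd_count_delete_at[of \<mu> "delete_at \<nu> w" K] *(1,3)
    by (auto simp: in_set_enumerate_eq dest: sym[of _ "w ! \<nu>"] sym[of _ "delete_at \<nu> w ! \<mu>"])
  with * show ?thesis
    using that set_delete_at by (metis subset_trans)
qed

lemma times_functional_result:
  assumes F: "homogeneous d F" and y: "y \<in> set (map no_pending (times_functional F G))"
  obtains r u P v where "y = DTerm r u P v {#} {}"
    "\<forall>l\<in>set v. fst l \<in> below [Lft] \<union> below [Rgt]" "odd_count (below [Lft]) v = d"
proof -
  obtain s t z where z: "s \<in> set F" "z \<in> set (times_term s t)" "y = no_pending z"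
    using y by (auto simp: times_functional_def)
  obtain r1 u1 P1 w1 r2 u2 P2 w2 r u P v where
    eqs: "s = FTerm r1 u1 P1 w1" "t = FTerm r2 u2 P2 w2" "z = FTerm r u P v"
    using fterm.exhaust by metis
  have "wdeg w1 = d"
    using F z(1) eqs(1) by (auto simp: homogeneous_def)
  moreover have "fst ` set v \<subseteq> below [Lft] \<union> below [Rgt] \<and> odd_count (below [Lft]) v = wdeg w1"
    using times_term_word z(2) unfolding eqs .
  ultimately show ?thesis
    using z(3) eqs(3) that by auto
qed

section \<open>The Laplacian as a derivation of the bracket\<close>

text \<open>Pointwise for each product word, $\Delta\beta = -\beta\Delta_{FF} - \beta\Delta_{GG}$ as explained
  in the beginning. The exponent of the sign is an integer because $|F|$ may be zero; then
  $\Delta_{FF}$ produces no term.\<close>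

lemma Laplace_Schouten:
  assumes F: "homogeneous d F"
  shows "evaluate (\<Delta> \<lbrakk>Loc F, Loc G\<rbrakk>\<^sub>S) Q C X w =
    evaluate \<lbrakk>\<Delta> (Loc F), Loc G\<rbrakk>\<^sub>S Q C X w
    + (-1) powi (int d - 1) * evaluate \<lbrakk>Loc F, \<Delta> (Loc G)\<rbrakk>\<^sub>S Q C X w"
proof -
  let ?L = "below [Lft]" and ?R = "below [Rgt]"
  let ?f = "\<lambda>t. if base t = Q then val (resolve t) C X w else 0"
  define Y where "Y = map no_pending (times_functional F G)"
  define one where "one A B y = (\<Sum>t\<leftarrow>laplace_term A B y. ?f t)" for A B y
  define two where "two A B C' D y = (\<Sum>t\<leftarrow>laplace_term A B y. one C' D t)" for A B C' D y
  have disj: "?L \<inter> ?R = {}" by (auto simp: below_def)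
  have univ: "below [] = UNIV" by (auto simp: below_def)
  have f: "scaling ?f"
    unfolding scaling_def using evaluate_scale by blast
  have one: "scaling (one A B)" for A B
    using scaling_laplace[OF f] by (simp add: one_def[abs_def])
  have two: "scaling (two A B C' D)" for A B C' D
    using scaling_laplace[OF one] by (simp add: two_def[abs_def])
  have anti: "two A B C' D y = - two C' D A B y" for A B C' D y
    unfolding two_def one_def by (rule laplace_term_anticommute[OF f])
  have sign0: "sign_term 0 A t = t" for A t by (cases t) simp
  have lp: "(\<Sum>t\<leftarrow>laplace_part A B Z. g t) = (\<Sum>y\<leftarrow>Z. \<Sum>t\<leftarrow>laplace_term A B y. g t)"
    for A B Z and g :: "_ \<Rightarrow> real"
    by (simp add: laplace_part_def sum_concat_map)
  have sum_cong: "(\<Sum>y\<leftarrow>Z. g y) = (\<Sum>y\<leftarrow>Z. h y)" if "\<And>y. y \<in> set Z \<Longrightarrow> g y = h y"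
    for Z and g h :: "_ \<Rightarrow> real"
    using that by (intro arg_cong[where f=sum_list] map_cong refl)

  have lhs: "evaluate (\<Delta> \<lbrakk>Loc F, Loc G\<rbrakk>\<^sub>S) Q C X w =
    (\<Sum>y\<leftarrow>Y. two ?L ?R UNIV UNIV (sign_term 1 ?L y) + two ?R ?L UNIV UNIV (sign_term 1 ?L y))"
    unfolding evaluate_def product_word.simps Y_def[symmetric] act.simps op_count.simps Let_def
      univ append_Nil sign0 list.map_ident lp map_append sum_list_append sum_list_addf
    by (simp add: two_def one_def o_def)
  have rhs1: "evaluate \<lbrakk>\<Delta> (Loc F), Loc G\<rbrakk>\<^sub>S Q C X w =
    (\<Sum>y\<leftarrow>Y. \<Sum>t\<leftarrow>laplace_term ?L ?L y. one ?L ?R (sign_term 1 ?L t) + one ?R ?L (sign_term 1 ?L t))"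
    unfolding evaluate_def product_word.simps Y_def[symmetric] act.simps op_count.simps Let_def
      univ append_Nil sign0 list.map_ident lp map_append sum_list_append sum_list_addf map_map o_def
    by (simp add: one_def)
  have rhs2: "evaluate \<lbrakk>Loc F, \<Delta> (Loc G)\<rbrakk>\<^sub>S Q C X w =
    (\<Sum>y\<leftarrow>Y. \<Sum>t\<leftarrow>laplace_term ?R ?R (sign_term 1 ?L y).
       one ?L ?R (sign_term 1 ?L t) + one ?R ?L (sign_term 1 ?L t))"
    unfolding evaluate_def product_word.simps Y_def[symmetric] act.simps op_count.simps Let_def
      univ append_Nil sign0 list.map_ident lp map_append sum_list_append sum_list_addf map_map o_def
    by (simp add: one_def)

  have "two ?L ?R UNIV UNIV (sign_term 1 ?L y) + two ?R ?L UNIV UNIV (sign_term 1 ?L y) =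
     (\<Sum>t\<leftarrow>laplace_term ?L ?L y. one ?L ?R (sign_term 1 ?L t) + one ?R ?L (sign_term 1 ?L t))
     + (-1) powi (int d - 1) * (\<Sum>t\<leftarrow>laplace_term ?R ?R (sign_term 1 ?L y).
       one ?L ?R (sign_term 1 ?L t) + one ?R ?L (sign_term 1 ?L t))" if "y \<in> set Y" for y
  proof -
    obtain r u P v where y: "y = DTerm r u P v {#} {}"
      and v: "\<forall>l\<in>set v. fst l \<in> ?L \<union> ?R" and d: "odd_count ?L v = d"
      using times_functional_result[OF F] \<open>y \<in> set Y\<close> unfolding Y_def by metis
    have sy: "g (sign_term 1 ?L y) = (-1) ^ d * g y" if "scaling g" for g
      using that by (simp add: y d scaling_def)
    \<comment> \<open>What the first operator leaves still has all its letters in the two arguments.\<close>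
    have split: "two A B UNIV UNIV y =
       two A B ?L ?L y + two A B ?R ?R y + two A B ?L ?R y + two A B ?R ?L y" for A B
      unfolding two_def sum_list_addf[symmetric]
    proof (rule sum_cong)
      fix t assume "t \<in> set (laplace_term A B y)"
      then obtain r' v' \<pi>' E' where t: "t = DTerm r' u P v' \<pi>' E'" "set v' \<subseteq> set v"
        unfolding y by (rule laplace_term_result)
      then have "\<forall>l\<in>set v'. fst l \<in> ?L \<union> ?R"
        using v by blast
      then show "one UNIV UNIV t = one ?L ?L t + one ?R ?R t + one ?L ?R t + one ?R ?L t"
        unfolding one_def t by (rule laplace_split[OF _ disj])
    qed
    \<comment> \<open>The bracket is applied to $\Delta F$, of degree \<open>d - 1\<close>; hence the minus sign.\<close>
    have s1: "(\<Sum>t\<leftarrow>laplace_term ?L ?L y. one A B (sign_term 1 ?L t)) = - ((-1) ^ d * two ?L ?L A B y)"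
      for A B
    proof -
      have "(\<Sum>t\<leftarrow>laplace_term ?L ?L y. one A B (sign_term 1 ?L t)) =
        (\<Sum>t\<leftarrow>laplace_term ?L ?L y. - ((-1) ^ d) * one A B t)"
      proof (rule sum_cong)
        fix t assume "t \<in> set (laplace_term ?L ?L y)"
        then obtain r' v' \<pi>' E' \<beta> where t: "t = DTerm r' u P v' \<pi>' E'" "\<beta> \<in> ?L"
          "odd_count ?L v' + of_bool (\<beta> \<in> ?L) = odd_count ?L v"
          unfolding y by (rule laplace_term_result) blast
        then have "d = Suc (odd_count ?L v')"
          using d by simp
        then show "one A B (sign_term 1 ?L t) = - ((-1) ^ d) * one A B t"
          using one[of A B] by (simp add: t(1) scaling_def)
      qed
      then show ?thesis
        unfolding sum_list_const_mult by (simp add: two_def)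
    qed
    \<comment> \<open>Both signs are $(-1)^{|F|}$: one since $\Delta$ passes through $F$, one from the bracket.\<close>
    have s2: "(\<Sum>t\<leftarrow>laplace_term ?R ?R (sign_term 1 ?L y). one A B (sign_term 1 ?L t)) =
      two ?R ?R A B y" for A B
    proof -
      have "(\<Sum>t\<leftarrow>laplace_term ?R ?R (sign_term 1 ?L y). one A B (sign_term 1 ?L t)) =
        (\<Sum>t\<leftarrow>laplace_term ?R ?R (sign_term 1 ?L y). (-1) ^ d * one A B t)"
      proof (rule sum_cong)
        fix t assume "t \<in> set (laplace_term ?R ?R (sign_term 1 ?L y))"
        then obtain r' v' \<pi>' E' \<beta> where t: "t = DTerm r' u P v' \<pi>' E'" "\<beta> \<in> ?R"
          "odd_count ?L v' + of_bool (\<beta> \<in> ?L) = odd_count ?L v"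
          unfolding y sign_term.simps by (rule laplace_term_result) blast
        then have "odd_count ?L v' = d"
          using d disj by auto
        then show "one A B (sign_term 1 ?L t) = (-1) ^ d * one A B t"
          using one[of A B] by (simp add: t(1) scaling_def)
      qed
      also have "\<dots> = (-1) ^ d * two ?R ?R A B (sign_term 1 ?L y)"
        unfolding sum_list_const_mult two_def ..
      also have "\<dots> = two ?R ?R A B y"
        unfolding sy[OF two] by (simp flip: mult.assoc power_add)
      finally show ?thesis .
    qed
    have powi: "(-1) powi (int d - 1) = - ((-1) ^ d :: real)"
      by (simp add: power_int_diff)
    \<comment> \<open>A part of the Laplacian anticommutes with itself, so that its square vanishes.\<close>
    have square: "two ?L ?R ?L ?R y = 0" "two ?R ?L ?R ?L y = 0"
      using anti[of ?L ?R ?L ?R y] anti[of ?R ?L ?R ?L y] by simp_all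
    show ?thesis
      unfolding sy[OF two] split sum_list_addf s1 s2 powi square
        anti[of ?L ?L] anti[of ?R ?R] anti[of ?R ?L ?L ?R]
      by (simp add: algebra_simps)
  qed
  then show ?thesis
    unfolding lhs rhs1 rhs2 sum_list_const_mult[symmetric] sum_list_addf[symmetric]
    by (rule sum_cong)
qed

section \<open>Equality of functionals\<close>

text \<open>Equal densities differ by the divergence of the zero current.\<close>

lemma same_functional_if_eq:
  assumes "\<And>Q C X w. H Q C X w = H' Q C X w"
  shows "same_functional atlas vol S H H'"
proof -
  have "current atlas S Q (\<lambda>_ _. [])" for Q :: "path set set"
    by (simp add: current_def val_def changed_def)
  moreover have "cyclic_null (\<lambda>w. H Q C X w - H' Q C X w - divergence vol Q (\<lambda>_ _. []) C X w)"
    for Q C X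
    unfolding cyclic_null_def
    by (rule exI[of _ "\<lambda>_. 0"]) (simp add: assms divergence_def val_def)
  ultimately show ?thesis
    unfolding same_functional_def by blast
qed

theorem theorem14:
  fixes atlas :: "('p::{t2_space, second_countable_topology}, 'n::finite) chart set"
    and vol :: "('p, 'n) chart \<Rightarrow> 'p \<Rightarrow> real"
    and S :: "(('p, 'n) chart \<Rightarrow> 'p \<Rightarrow> real) set"
    and F G :: "('p, 'm::finite, 'n) fterm list"
    and d :: nat
  assumes "affine_manifold atlas vol"
    and "decay_class atlas vol S"
    and "local_functional atlas S F"
    and "local_functional atlas S G"
    and "homogeneous d F"
  shows "same_functional atlas vol S
    (evaluate (\<Delta> \<lbrakk>Loc F, Loc G\<rbrakk>\<^sub>S))
    (\<lambda>Q C X w. evaluate \<lbrakk>\<Delta> (Loc F), Loc G\<rbrakk>\<^sub>S Q C X w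
       + (-1) powi (int d - 1) * evaluate \<lbrakk>Loc F, \<Delta> (Loc G)\<rbrakk>\<^sub>S Q C X w)"
  by (rule same_functional_if_eq) (rule Laplace_Schouten[OF assms(5)])

end
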